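(* Let $d\ge 2$ be an integer, let $\mu$ be a Radon measure on $\mathsf{T}_d$, and let $\rho>0$ and $0<\vartheta<1$ be two constants such that for any double sequence $a(N,n)$ of complex numbers ($N\in\mathbb{N}$, $1\le n\le N$) with $\max_{n=1,\ldots,N}|a(N,n)|\le N^{o(1)}$ as $N\to\infty$ one has $$\int_{\mathsf{T}_d}\left|\sum_{n=1}^N a(N,n)\,\mathbf{e}(x_1n+\ldots+x_dn^d)\right|^{\rho}d\mu(\mathbf{x})\le N^{\vartheta\rho+o(1)},\qquad N\to\infty.$$ Then for any complex sequence $\mathbf{a}=(a_n)_{n=1}^\infty$ with $a_n=n^{o(1)}$ and for $\mu$-almost all $\mathbf{x}\in\operatorname{spt}\mu$ we have $$|S_{\mathbf{a},d}(\mathbf{x};N)|\le N^{\vartheta+o(1)},\qquad N\to\infty.$$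
   Context: $\mathsf{T}_d=(\mathbb{R}/\mathbb{Z})^d$ is the unit torus, identified with $[0,1)^d$; a Radon measure $\mu$ on $\mathsf{T}_d$ is a (nonnegative) Borel measure with $\mu(\mathsf{T}_d)<\infty$. The support $\operatorname{spt}\mu$ is the smallest closed set whose complement has $\mu$-measure zero. Write $\mathbf{e}(x)=\exp(2\pi i x)$. For $\mathbf{x}=(x_1,\dots,x_d)$ and $N\in\mathbb{N}$, $S_{\mathbf{a},d}(\mathbf{x};N)=\sum_{n=1}^N a_n\,\mathbf{e}(x_1n+x_2n^2+\ldots+x_dn^d)$. $U=V^{o(1)}$ means that for every $\varepsilon>0$, $|U|\le V^{\varepsilon}$ once $V$ is large enough; accordingly $A(N)\le N^{c+o(1)}$ means that for every $\varepsilon>0$, $A(N)\le N^{c+\varepsilon}$ for all sufficiently large $N$ (for the almost-all statement, how large may depend on $\mathbf{x}$). *)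

theory Defs
  imports "HOL-Analysis.Analysis"
begin

text \<open>
  Points \<open>x = (x\<^sub>1, \<dots>, x\<^sub>d)\<close> are functions \<open>nat \<Rightarrow> real\<close> on the index set \<open>{1..d}\<close>, extensional
  outside it. The torus is identified as a set with \<open>[0,1)\<^sup>d\<close>, but it carries the quotient
  topology of \<open>\<real>\<^sup>d / \<int>\<^sup>d\<close>, in which opposite faces of the cube are glued, and not the subspace
  topology of the half-open cube.
\<close>

definition torus :: "nat \<Rightarrow> (nat \<Rightarrow> real) set" where
  "torus d = {1..d} \<rightarrow>\<^sub>E {0..<1}"

definition real_space :: "nat \<Rightarrow> (nat \<Rightarrow> real) topology" where
  "real_space d = product_topology (\<lambda>_. euclideanreal) {1..d}"

definition torus_proj :: "nat \<Rightarrow> (nat \<Rightarrow> real) \<Rightarrow> (nat \<Rightarrow> real)" where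
  "torus_proj d x = (\<lambda>j\<in>{1..d}. frac (x j))"

definition torus_topology :: "nat \<Rightarrow> (nat \<Rightarrow> real) topology" where
  "torus_topology d = topology (\<lambda>U. U \<subseteq> torus d \<and>
     openin (real_space d) {x \<in> topspace (real_space d). torus_proj d x \<in> U})"

definition radon_measure_on_torus :: "nat \<Rightarrow> (nat \<Rightarrow> real) measure \<Rightarrow> bool" where
  "radon_measure_on_torus d \<mu> \<longleftrightarrow>
     space \<mu> = torus d \<and>
     sets \<mu> = sigma_sets (torus d) {U. openin (torus_topology d) U} \<and>
     emeasure \<mu> (torus d) < \<infinity>"

definition spt :: "nat \<Rightarrow> (nat \<Rightarrow> real) measure \<Rightarrow> (nat \<Rightarrow> real) set" where
  "spt d \<mu> = \<Inter>{C. closedin (torus_topology d) C \<and> emeasure \<mu> (torus d - C) = 0}"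

definition e :: "real \<Rightarrow> complex" where
  "e t = exp (2 * complex_of_real pi * \<i> * complex_of_real t)"

definition weyl_sum :: "(nat \<Rightarrow> complex) \<Rightarrow> nat \<Rightarrow> (nat \<Rightarrow> real) \<Rightarrow> nat \<Rightarrow> complex" where
  "weyl_sum a d x N = (\<Sum>n=1..N. a n * e (\<Sum>j=1..d. x j * real n ^ j))"

text \<open>The relation \<open>A(N) \<le> N\<^bsup>c + o(1)\<^esup>\<close> as \<open>N \<rightarrow> \<infinity>\<close>; it is only used for \<open>A \<ge> 0\<close>.\<close>

definition le_power_o1 :: "(nat \<Rightarrow> real) \<Rightarrow> real \<Rightarrow> bool" where
  "le_power_o1 A c \<longleftrightarrow> (\<forall>\<epsilon>>0. \<forall>\<^sub>F N in sequentially. A N \<le> real N powr (c + \<epsilon>))"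

lemma topspace_real_space: "topspace (real_space d) = {1..d} \<rightarrow>\<^sub>E UNIV"
  by (simp add: real_space_def)

lemma torus_proj_in: "torus_proj d x \<in> torus d"
  by (auto simp: torus_proj_def torus_def frac_lt_1)

lemma torus_proj_id: "x \<in> torus d \<Longrightarrow> torus_proj d x = x"
  by (fastforce simp: torus_proj_def torus_def PiE_iff extensional_def frac_eq)

lemma torus_subset: "torus d \<subseteq> topspace (real_space d)"
  by (auto simp: topspace_real_space torus_def PiE_iff)

lemma openin_torus_topology:
  "openin (torus_topology d) U \<longleftrightarrow> U \<subseteq> torus d \<and>
     openin (real_space d) {x \<in> topspace (real_space d). torus_proj d x \<in> U}"
proof -
  let ?P = "\<lambda>U. U \<subseteq> torus d \<and>
     openin (real_space d) {x \<in> topspace (real_space d). torus_proj d x \<in> U}"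
  have 1: "?P (S \<inter> T)" if "?P S" "?P T" for S T
  proof -
    have "{x \<in> topspace (real_space d). torus_proj d x \<in> S \<inter> T} =
      {x \<in> topspace (real_space d). torus_proj d x \<in> S} \<inter>
      {x \<in> topspace (real_space d). torus_proj d x \<in> T}" by auto
    with that show ?thesis by (auto intro: openin_Int)
  qed
  have 2: "?P (\<Union>\<K>)" if "\<forall>K\<in>\<K>. ?P K" for \<K>
  proof -
    have "{x \<in> topspace (real_space d). torus_proj d x \<in> \<Union>\<K>} =
      (\<Union>K\<in>\<K>. {x \<in> topspace (real_space d). torus_proj d x \<in> K})" by auto
    with that show ?thesis by (auto intro: openin_Union)
  qed
  have "istopology ?P"
    unfolding istopology_def using 1 2 by blast
  then show ?thesis
    by (simp add: torus_topology_def topology_inverse')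
qed

lemma topspace_torus_topology: "topspace (torus_topology d) = torus d"
proof
  show "topspace (torus_topology d) \<subseteq> torus d"
    using openin_torus_topology openin_topspace by blast
  have "openin (torus_topology d) (torus d)"
    by (simp add: openin_torus_topology torus_proj_in)
  then show "torus d \<subseteq> topspace (torus_topology d)"
    by (rule openin_subset)
qed

lemma quotient_map_torus_proj:
  "quotient_map (real_space d) (torus_topology d) (torus_proj d)"
proof -
  have "torus_proj d ` topspace (real_space d) = torus d"
    using torus_proj_in torus_proj_id torus_subset by (metis image_subset_iff subsetI subset_antisym image_eqI subsetD)
  then show ?thesis
    by (simp add: quotient_map_def topspace_torus_topology openin_torus_topology)
qed

text \<open>
  \<open>spt d \<mu>\<close> is closed with a \<open>\<mu>\<close>-null complement, hence the smallest such set: the complement is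
  a union of open null sets, and countably many of them suffice.
\<close>

lemma closedin_spt: "closedin (torus_topology d) (spt d \<mu>)"
proof -
  have "closedin (torus_topology d) (torus d)"
    by (metis closedin_topspace topspace_torus_topology)
  then have "torus d \<in> {C. closedin (torus_topology d) C \<and> emeasure \<mu> (torus d - C) = 0}"
    by simp
  then show ?thesis
    unfolding spt_def by (intro closedin_Inter) auto
qed

lemma open_torus_proj_vimage:
  assumes "openin (torus_topology d) U"
  shows "open (torus_proj d -` U)"
proof -
  have c: "continuous_map euclidean (real_space d) (\<lambda>x. restrict x {1..d})"
    by (auto simp: real_space_def continuous_map_componentwise intro: continuous_on_product_coordinates)
  have "openin (real_space d) {x \<in> topspace (real_space d). torus_proj d x \<in> U}" (is "openin _ ?V")
    using assms by (simp add: openin_torus_topology)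
  then have "openin euclidean {x \<in> topspace euclidean. restrict x {1..d} \<in> ?V}"
    by (rule openin_continuous_map_preimage[OF c])
  moreover have "torus_proj d (restrict x {1..d}) = torus_proj d x" for x
    by (auto simp: torus_proj_def)
  ultimately show ?thesis
    by (simp add: vimage_def topspace_real_space flip: open_openin)
qed

lemma emeasure_compl_spt:
  assumes "radon_measure_on_torus d \<mu>"
  shows "emeasure \<mu> (torus d - spt d \<mu>) = 0"
proof -
  define F where "F = {U. openin (torus_topology d) U \<and> emeasure \<mu> U = 0}"
  have sets: "U \<in> sets \<mu>" if "openin (torus_topology d) U" for U
    using assms that by (auto simp: radon_measure_on_torus_def)
  obtain G where G: "G \<subseteq> (\<lambda>U. torus_proj d -` U) ` F" "countable G"
      "\<Union>G = \<Union>((\<lambda>U. torus_proj d -` U) ` F)"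
    using Lindelof[of "(\<lambda>U. torus_proj d -` U) ` F"] open_torus_proj_vimage
    unfolding F_def by blast
  then obtain H where H: "H \<subseteq> F" "countable H" "G = (\<lambda>U. torus_proj d -` U) ` H"
    by (meson countable_subset_image)
  have "U \<subseteq> torus d" if "U \<in> F" for U
    using that by (simp add: F_def openin_torus_topology)
  then have "\<Union>F \<subseteq> \<Union>H"
    using G(3) unfolding H(3) by (auto simp: set_eq_iff) (metis subsetD torus_proj_id)
  moreover have "torus d - spt d \<mu> \<subseteq> \<Union>F"
    unfolding spt_def F_def
    by (auto simp: closedin_def topspace_torus_topology)
  moreover have "(\<Union>U\<in>H. U) \<in> null_sets \<mu>"
    using H(1,2) sets by (intro null_sets_UN') (auto simp: F_def null_sets_def)
  moreover have "torus d - spt d \<mu> \<in> sets \<mu>"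
    using closedin_spt[of d \<mu>] by (intro sets) (simp add: closedin_def topspace_torus_topology)
  ultimately show ?thesis
    by (metis image_ident null_setsD1 null_sets_subset subset_trans)
qed

end

theory Submission
  imports Defs "HOL-Real_Asymp.Real_Asymp"
begin

text \<open>
  The maximal function \<open>sup\<^bsub>m \<le> 2^k\<^esub> |S(x; m)|\<close> is controlled by dyadic chaining,
  uniformly in \<open>\<rho> > 0\<close>. An initial segment of \<open>{1..2^k}\<close> is a disjoint union of at most one
  dyadic block of each length \<open>2^j\<close>, \<open>j \<le> k\<close>. For a fixed \<open>j\<close>, attach signs to the blocks: for
  each block sum \<open>g\<^sub>i\<close>, at least one of every two sign patterns that differ only at \<open>i\<close> makes the
  signed total at least \<open>|g\<^sub>i|\<close> in modulus, so \<open>max\<^sub>i |g\<^sub>i|\<^sup>\<rho>\<close> is at most twice the average over signs of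
  \<open>|\<Sum>\<^sub>i \<plusminus>g\<^sub>i|\<^sup>\<rho>\<close>. The hypothesis bounds the integral of each term of this average, since changing
  signs does not affect the size of the coefficients. Chebyshev's inequality and the
  Borel-Cantelli lemma along \<open>N = 2^k\<close> conclude.
\<close>

section \<open>Sign averages and a Chebyshev bound\<close>

lemma sign_sum_ge:
  fixes g :: "'i \<Rightarrow> complex"
  assumes I: "finite I" "i \<in> I" and "\<rho> > 0"
  shows "2 ^ card I * cmod (g i) powr \<rho> \<le>
    2 * (\<Sum>A\<in>Pow I. cmod (\<Sum>j\<in>I. (if j \<in> A then 1 else -1) * g j) powr \<rho>)"
proof -
  define \<phi> where "\<phi> A = cmod (\<Sum>j\<in>I. (if j \<in> A then 1 else -1) * g j) powr \<rho>" for A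
  define J where "J = I - {i}"
  have J: "finite J" "i \<notin> J" and IJ: "I = insert i J"
    using I by (auto simp: J_def)
  have pair: "cmod (g i) powr \<rho> \<le> \<phi> A + \<phi> (insert i A)" if "A \<subseteq> J" for A
  proof -
    define z where "z = (\<Sum>j\<in>J. (if j \<in> A then 1 else -1) * g j)"
    have "i \<notin> A" using that J by auto
    then have minus: "\<phi> A = cmod (z - g i) powr \<rho>"
      using J unfolding \<phi>_def IJ by (simp add: z_def)
    have "(\<Sum>j\<in>J. (if j \<in> insert i A then 1 else -1) * g j) = z"
      unfolding z_def using J by (intro sum.cong) auto
    then have plus: "\<phi> (insert i A) = cmod (z + g i) powr \<rho>"
      using J unfolding \<phi>_def IJ by (simp add: add.commute)
    \<comment> \<open>The two patterns differing only at \<open>i\<close> give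
      \<open>z + g i\<close> and \<open>z - g i\<close>. One of them has modulus at least that of
      \<open>g i\<close>, and then only monotonicity of the power is used, so exponents \<rho> < 1
      are covered as well.\<close>
    have "2 * cmod (g i) = cmod ((z + g i) - (z - g i))"
      by (simp add: norm_mult flip: mult_2)
    also have "\<dots> \<le> cmod (z + g i) + cmod (z - g i)"
      by (rule norm_triangle_ineq4)
    finally consider "cmod (g i) \<le> cmod (z + g i)" | "cmod (g i) \<le> cmod (z - g i)"
      by linarith
    then show ?thesis
    proof cases
      case 1
      then have "cmod (g i) powr \<rho> \<le> cmod (z + g i) powr \<rho>"
        using \<open>\<rho> > 0\<close> by (intro powr_mono2) auto
      then show ?thesis by (simp add: minus plus add_increasing)
    next
      case 2
      then have "cmod (g i) powr \<rho> \<le> cmod (z - g i) powr \<rho>"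
        using \<open>\<rho> > 0\<close> by (intro powr_mono2) auto
      then show ?thesis by (simp add: minus plus add_increasing2)
    qed
  qed
  \<comment> \<open>Summing over subsets of \<open>J\<close> meets every subset of \<open>I\<close>
    exactly once. There are half as many pairs as subsets, whence the factor 2 in the
    statement.\<close>
  have "2 ^ card J * cmod (g i) powr \<rho> = (\<Sum>A\<in>Pow J. cmod (g i) powr \<rho>)"
    using J by (simp add: card_Pow)
  also have "\<dots> \<le> (\<Sum>A\<in>Pow J. \<phi> A + \<phi> (insert i A))"
    using pair by (intro sum_mono) auto
  also have "\<dots> = sum \<phi> (Pow J) + sum \<phi> (insert i ` Pow J)"
    using J by (subst sum.reindex) (auto simp: sum.distrib inj_on_def)
  also have "\<dots> = sum \<phi> (Pow I)"
    unfolding IJ Pow_insert using J by (subst sum.union_disjoint) auto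
  finally show ?thesis
    using J by (simp add: IJ \<phi>_def)
qed

text \<open>Chebyshev's inequality for the sign average in place of a union bound over
  \<open>I\<close>: the loss is a factor 2, whatever the size of \<open>I\<close>. The bound
  \<open>B\<close> supplies the integrability of the signed sums.\<close>

lemma (in finite_measure) measure_ex_large_le:
  fixes g :: "'i \<Rightarrow> 'a \<Rightarrow> complex"
  assumes I: "finite I" and "\<rho> > 0" and "t > 0"
    and g: "\<And>i. i \<in> I \<Longrightarrow> g i \<in> borel_measurable M"
    and B: "\<And>i x. i \<in> I \<Longrightarrow> x \<in> space M \<Longrightarrow> cmod (g i x) \<le> B"
    and K: "\<And>A. (\<integral>x. cmod (\<Sum>i\<in>I. (if i \<in> A then 1 else -1) * g i x) powr \<rho> \<partial>M) \<le> K"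
  shows "measure M {x\<in>space M. \<exists>i\<in>I. cmod (g i x) > t} \<le> 2 * K / t powr \<rho>"
proof -
  define E where "E = {x\<in>space M. \<exists>i\<in>I. cmod (g i x) > t}"
  define \<phi> where "\<phi> A x = cmod (\<Sum>i\<in>I. (if i \<in> A then 1 else -1) * g i x) powr \<rho>" for A x
  have [measurable]: "E \<in> sets M"
    unfolding E_def using I g by measurable
  have \<phi>_meas: "\<phi> A \<in> borel_measurable M" for A
    unfolding \<phi>_def using g by measurable
  have \<phi>_int: "integrable M (\<phi> A)" for A
  proof (rule integrable_const_bound[OF AE_I2 \<phi>_meas])
    fix x assume x: "x \<in> space M"
    have "cmod (\<Sum>i\<in>I. (if i \<in> A then 1 else -1) * g i x) \<le> (\<Sum>i\<in>I. B)"
      using B[OF _ x] by (intro sum_norm_le) (auto simp: norm_mult)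
    then show "norm (\<phi> A x) \<le> (\<Sum>i\<in>I. B) powr \<rho>"
      using \<open>\<rho> > 0\<close> unfolding \<phi>_def by (simp add: powr_mono2)
  qed
  have "2 ^ card I * t powr \<rho> * indicator E x \<le> 2 * (\<Sum>A\<in>Pow I. \<phi> A x)" for x
  proof (cases "x \<in> E")
    case True
    then obtain i where i: "i \<in> I" "cmod (g i x) > t" by (auto simp: E_def)
    then have "2 ^ card I * t powr \<rho> \<le> 2 ^ card I * cmod (g i x) powr \<rho>"
      using \<open>\<rho> > 0\<close> \<open>t > 0\<close> by (intro mult_left_mono powr_mono2) auto
    also have "\<dots> \<le> 2 * (\<Sum>A\<in>Pow I. \<phi> A x)"
      unfolding \<phi>_def by (rule sign_sum_ge) (use I i \<open>\<rho> > 0\<close> in auto)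
    finally show ?thesis using True by simp
  next
    case False
    then show ?thesis by (simp add: \<phi>_def sum_nonneg)
  qed
  then have "(\<integral>x. 2 ^ card I * t powr \<rho> * indicator E x \<partial>M) \<le> (\<integral>x. 2 * (\<Sum>A\<in>Pow I. \<phi> A x) \<partial>M)"
    using \<phi>_int by (intro integral_mono integrable_mult_right Bochner_Integration.integrable_sum
      integrable_real_indicator) (auto simp: less_top[symmetric])
  then have "2 ^ card I * t powr \<rho> * measure M E \<le> 2 * (\<Sum>A\<in>Pow I. \<integral>x. \<phi> A x \<partial>M)"
    using \<phi>_int by simp
  also have "\<dots> \<le> 2 * (\<Sum>A\<in>Pow I. K)"
    using K by (intro mult_left_mono sum_mono) (auto simp: \<phi>_def)
  also have "\<dots> = 2 ^ card I * (2 * K)"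
    using I by (simp add: card_Pow)
  finally have "t powr \<rho> * measure M E \<le> 2 * K"
    by (simp add: mult.assoc mult_le_cancel_left_pos)
  then show ?thesis
    using \<open>t > 0\<close> by (simp add: E_def pos_le_divide_eq mult.commute)
qed

section \<open>Dyadic chaining and the maximal inequality\<close>

lemma dyadic_blocks_sum:
  fixes h :: "nat \<Rightarrow> 'a::comm_monoid_add"
  shows "(\<Sum>i<m. \<Sum>n\<in>{i * b<..Suc i * b}. h n) = (\<Sum>n=1..m * b. h n)"
proof (induction m)
  case (Suc m)
  have "{1..Suc m * b} = {1..m * b} \<union> {m * b<..Suc m * b}" by auto
  then have "(\<Sum>n=1..Suc m * b. h n) = (\<Sum>n=1..m * b. h n) + (\<Sum>n\<in>{m * b<..Suc m * b}. h n)"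
    by (simp only:) (rule sum.union_disjoint; auto)
  then show ?case using Suc by simp
qed simp

text \<open>Chaining along the truncations of the binary expansion of \<open>m\<close>: passing from
  \<open>2\<^sup>j\<^sup>+\<^sup>1 \<lfloor>m / 2\<^sup>j\<^sup>+\<^sup>1\<rfloor>\<close> to \<open>2\<^sup>j \<lfloor>m / 2\<^sup>j\<rfloor>\<close> adds at most one dyadic block of length \<open>2\<^sup>j\<close>.\<close>

lemma norm_partial_sum_le_dyadic:
  fixes h :: "nat \<Rightarrow> 'a::real_normed_vector"
  assumes "m \<le> 2 ^ k"
    and block: "\<And>j i. j \<le> k \<Longrightarrow> i < 2 ^ (k - j) \<Longrightarrow> norm (\<Sum>n\<in>{i * 2 ^ j<..Suc i * 2 ^ j}. h n) \<le> t"
  shows "norm (\<Sum>n=1..m. h n) \<le> (real k + 1) * t"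
proof -
  have t: "t \<ge> 0"
    by (rule order_trans[OF norm_ge_zero block[of k 0]]) auto
  have "norm (\<Sum>n=1..(m div 2 ^ (k - l)) * 2 ^ (k - l). h n) \<le> (real l + 1) * t" if "l \<le> k" for l
    using that
  \<comment> \<open>The scale 2^(k - l) runs from coarse to fine. At l = k it is 1, and the
    truncation of \<open>m\<close> is \<open>m\<close> itself.\<close>
  proof (induction l)
    case 0
    \<comment> \<open>The value 1 occurs only for m = 2^k, where the sum is the single block of
      length 2^k. Otherwise the sum is empty.\<close>
    have "m div 2 ^ k = 0 \<or> m div 2 ^ k = 1"
      using assms(1) by (cases "m = 2 ^ k") auto
    moreover have "{1..2 ^ k} = {0<..2 ^ k :: nat}" by auto
    ultimately show ?case
      using block[of k 0] t by auto
  next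
    case (Suc l)
    define j where "j = k - Suc l"
    define q where "q = m div 2 ^ Suc j"
    have kl: "k - l = Suc j" using Suc.prems by (simp add: j_def)
    have IH: "norm (\<Sum>n=1..2 * q * 2 ^ j. h n) \<le> (real l + 1) * t"
      using Suc by (simp add: kl q_def mult_ac)
    have q: "q = (m div 2 ^ j) div 2"
      by (simp only: q_def power_Suc2 div_mult2_eq)
    show ?case
    proof (cases "m div 2 ^ j = 2 * q")
      case True
      then show ?thesis using IH t by (simp add: j_def distrib_right)
    next
      case False
      \<comment> \<open>The binary digit of \<open>m\<close> at position \<open>j\<close> is 1, so
        the block with index 2q is added.\<close>
      then have eq: "m div 2 ^ j = Suc (2 * q)" using q by linarith
      have "m div 2 ^ j \<le> 2 ^ k div 2 ^ j" using assms(1) by (rule div_le_mono)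
      also have "2 ^ k div 2 ^ j = (2 ^ (k - j) :: nat)"
        by (simp add: j_def power_diff)
      finally have "2 * q < 2 ^ (k - j)" using eq by simp
      then have b: "norm (\<Sum>n\<in>{(2*q) * 2 ^ j<..Suc (2*q) * 2 ^ j}. h n) \<le> t"
        by (intro block) (simp_all add: j_def)
      have "{1..Suc (2*q) * 2^j} = {1..(2*q) * 2^j} \<union> {(2*q) * 2^j<..Suc (2*q) * 2^j}" by auto
      then have "(\<Sum>n=1..Suc (2*q) * 2^j. h n) =
          (\<Sum>n=1..(2*q) * 2^j. h n) + (\<Sum>n\<in>{(2*q) * 2^j<..Suc (2*q) * 2^j}. h n)"
        by (simp only:) (rule sum.union_disjoint; auto)
      also have "norm \<dots> \<le> (real l + 1) * t + t"
        using IH b by (intro norm_triangle_le) simp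
      finally show ?thesis
        by (simp add: eq flip: j_def) (simp add: algebra_simps)
    qed
  qed
  from this[of k] show ?thesis by simp
qed

text \<open>By chaining, a large partial sum forces a large block at one of the k + 1 scales, and
  the union bound runs over scales only. Within a scale \<open>measure_ex_large_le\<close> treats
  all blocks at once; its sign patterns on blocks are sign patterns on indices, so \<open>K\<close>
  bounds their integrals too.\<close>

lemma (in finite_measure) measure_maximal_partial_sum_le:
  fixes h :: "nat \<Rightarrow> 'a \<Rightarrow> complex"
  assumes "\<rho> > 0" and "t > 0"
    and h[measurable]: "\<And>n. h n \<in> borel_measurable M"
    and B: "\<And>n x. n \<in> {1..2 ^ k} \<Longrightarrow> x \<in> space M \<Longrightarrow> cmod (h n x) \<le> B"
    and K: "\<And>A. (\<integral>x. cmod (\<Sum>n=1..2 ^ k. (if n \<in> A then 1 else -1) * h n x) powr \<rho> \<partial>M) \<le> K"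
  shows "measure M {x\<in>space M. \<exists>m\<le>2 ^ k. cmod (\<Sum>n=1..m. h n x) > (real k + 1) * t}
    \<le> (real k + 1) * (2 * K / t powr \<rho>)"
proof -
  define g where "g j i x = (\<Sum>n\<in>{i * 2 ^ j<..Suc i * 2 ^ j}. h n x)" for j i x
  have [measurable]: "g j i \<in> borel_measurable M" for j i
    unfolding g_def by measurable
  define E where "E j = {x\<in>space M. \<exists>i\<in>{..<2 ^ (k - j)}. cmod (g j i x) > t}" for j
  have [measurable]: "E j \<in> sets M" for j
    unfolding E_def by measurable
  have E: "measure M (E j) \<le> 2 * K / t powr \<rho>" if "j \<le> k" for j
    unfolding E_def
  proof (rule measure_ex_large_le)
    fix i :: nat and x assume i: "i \<in> {..<2 ^ (k - j)}" and x: "x \<in> space M"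
    have "Suc i * 2 ^ j \<le> 2 ^ (k - j) * 2 ^ j"
      using i by (intro mult_right_mono) auto
    also have "\<dots> = 2 ^ k"
      using that by (simp flip: power_add)
    finally have "n \<in> {1..2^k}" if "n \<in> {i * 2 ^ j<..Suc i * 2 ^ j}" for n
      using that by auto
    then have "cmod (g j i x) \<le> (\<Sum>n\<in>{i * 2 ^ j<..Suc i * 2 ^ j}. B)"
      unfolding g_def using B x by (intro sum_norm_le) blast
    then show "cmod (g j i x) \<le> 2 ^ j * B" by simp
  next
    fix A :: "nat set"
    \<comment> \<open>Spreads the sign of a block over its indices. Blocks are open on the left and
      closed on the right, so the block containing \<open>n\<close> has index (n - 1) div
      2^j.\<close>
    define A' where "A' = {n. (n - 1) div 2 ^ j \<in> A}"
    have "(if i \<in> A then 1 else -1) * g j i x =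
        (\<Sum>n\<in>{i * 2 ^ j<..Suc i * 2 ^ j}. (if n \<in> A' then 1 else -1) * h n x)" for i x
      unfolding g_def sum_distrib_left
    proof (rule sum.cong)
      fix n assume n: "n \<in> {i * 2 ^ j<..Suc i * 2 ^ j}"
      then have "(n - 1) div 2 ^ j = i"
        by (intro div_nat_eqI) (auto simp: mult.commute)
      then show "(if i \<in> A then 1 else -1) * h n x = (if n \<in> A' then 1 else -1) * h n x"
        by (simp add: A'_def)
    qed simp
    then have "(\<Sum>i<2 ^ (k - j). (if i \<in> A then 1 else -1) * g j i x) =
        (\<Sum>n=1..2 ^ (k - j) * 2 ^ j. (if n \<in> A' then 1 else -1) * h n x)" for x
      by (simp only: dyadic_blocks_sum)
    moreover have "2 ^ (k - j) * 2 ^ j = (2 ^ k :: nat)"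
      using that by (simp flip: power_add)
    ultimately show "(\<integral>x. cmod (\<Sum>i<2 ^ (k - j). (if i \<in> A then 1 else -1) * g j i x) powr \<rho> \<partial>M) \<le> K"
      using K[of A'] by simp
  qed (use assms in auto)
  have "{x\<in>space M. \<exists>m\<le>2 ^ k. cmod (\<Sum>n=1..m. h n x) > (real k + 1) * t} \<subseteq> (\<Union>j\<le>k. E j)"
  proof safe
    fix x m assume x: "x \<in> space M" and m: "m \<le> 2 ^ k" "cmod (\<Sum>n=1..m. h n x) > (real k + 1) * t"
    show "x \<in> (\<Union>j\<le>k. E j)"
    proof (rule ccontr)
      assume "x \<notin> (\<Union>j\<le>k. E j)"
      then have "cmod (\<Sum>n=1..m. h n x) \<le> (real k + 1) * t"
        using m(1) x by (intro norm_partial_sum_le_dyadic) (auto simp: E_def g_def not_less)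
      with m(2) show False by simp
    qed
  qed
  then have "measure M {x\<in>space M. \<exists>m\<le>2 ^ k. cmod (\<Sum>n=1..m. h n x) > (real k + 1) * t}
      \<le> measure M (\<Union>j\<le>k. E j)"
    by (intro finite_measure_mono) auto
  also have "\<dots> \<le> (\<Sum>j\<le>k. measure M (E j))"
    by (intro finite_measure_subadditive_finite) auto
  also have "\<dots> \<le> (\<Sum>j\<le>k. 2 * K / t powr \<rho>)"
    using E by (intro sum_mono) auto
  finally show ?thesis by (simp add: add.commute)
qed

section \<open>Weyl sums on the torus: periodicity, continuity, measurability\<close>

lemma e_add_int: "e (t + of_int m) = e t"
proof -
  have "exp (2 * complex_of_real pi * \<i> * of_int m) = 1"
    by (subst exp_eq_1) (auto simp: intro!: exI[of _ m])
  then show ?thesis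
    by (simp add: e_def distrib_left exp_add)
qed

lemma cmod_e [simp]: "cmod (e t) = 1"
  by (simp add: e_def)

text \<open>Reducing the coordinates modulo 1 changes each phase by an integer, because
  \<open>n\<close> is an integer. Hence the Weyl sum descends to the quotient.\<close>

lemma weyl_sum_torus_proj: "weyl_sum a d (torus_proj d x) N = weyl_sum a d x N"
proof -
  have "e (\<Sum>j=1..d. torus_proj d x j * real n ^ j) = e (\<Sum>j=1..d. x j * real n ^ j)" for n
  proof -
    have "(\<Sum>j=1..d. x j * real n ^ j) =
        (\<Sum>j=1..d. torus_proj d x j * real n ^ j) + of_int (\<Sum>j=1..d. \<lfloor>x j\<rfloor> * int n ^ j)"
      by (simp add: torus_proj_def frac_def algebra_simps sum_subtractf)
    then show ?thesis by (simp only: e_add_int)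
  qed
  then show ?thesis by (simp add: weyl_sum_def)
qed

text \<open>By the universal property of the quotient map, continuity need only be checked for the
  periodic function on \<open>real_space d\<close>, where it is a finite sum of continuous
  terms.\<close>

lemma continuous_map_weyl_sum:
  "continuous_map (torus_topology d) euclidean (\<lambda>x. weyl_sum a d x N)"
proof -
  have "continuous_map (real_space d) euclideanreal (\<lambda>x. x j)" if "j \<in> {1..d}" for j
    unfolding real_space_def using that by (rule continuous_map_product_projection)
  then have phase: "continuous_map (real_space d) euclideanreal (\<lambda>x. \<Sum>j=1..d. x j * real n ^ j)" for n
    by (intro continuous_map_sum continuous_map_real_mult) auto
  have "continuous_on UNIV e"
    unfolding e_def by (intro continuous_intros)
  then have "continuous_map euclideanreal euclidean (\<lambda>t. a n * e t)" for n
    by (auto intro: continuous_intros)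
  then have "continuous_map (real_space d) euclidean (\<lambda>x. weyl_sum a d x N)"
    unfolding weyl_sum_def
    by (intro continuous_map_sum continuous_map_compose[OF phase, unfolded comp_def]) auto
  then show ?thesis
    using continuous_compose_quotient_map_eq[OF quotient_map_torus_proj, of d euclidean "\<lambda>x. weyl_sum a d x N"]
    by (simp add: comp_def weyl_sum_torus_proj)
qed

lemma borel_measurable_weyl_sum:
  assumes "radon_measure_on_torus d \<mu>"
  shows "(\<lambda>x. weyl_sum a d x N) \<in> borel_measurable \<mu>"
proof (rule borel_measurableI)
  fix S :: "complex set" assume "open S"
  then have "openin (torus_topology d) {x \<in> topspace (torus_topology d). weyl_sum a d x N \<in> S}"
    using continuous_map_weyl_sum openin_continuous_map_preimage open_openin by blast
  moreover have "(\<lambda>x. weyl_sum a d x N) -` S \<inter> space \<mu> = {x \<in> torus d. weyl_sum a d x N \<in> S}"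
    using assms by (auto simp: radon_measure_on_torus_def)
  ultimately show "(\<lambda>x. weyl_sum a d x N) -` S \<inter> space \<mu> \<in> sets \<mu>"
    using assms by (auto simp: radon_measure_on_torus_def topspace_torus_topology)
qed

section \<open>Bounds with o(1) exponents\<close>

text \<open>Turns a_n = n^o(1) into the condition on maxima that the hypothesis on mean values asks
  for. The finitely many early terms are absorbed by a constant.\<close>

lemma le_power_o1_Max:
  fixes u :: "nat \<Rightarrow> real"
  assumes "le_power_o1 u 0"
  shows "le_power_o1 (\<lambda>N. MAX n\<in>{1..N}. u n) 0"
  unfolding le_power_o1_def
proof safe
  fix \<epsilon> :: real assume "\<epsilon> > 0"
  then obtain n0 where n0: "\<And>n. n \<ge> n0 \<Longrightarrow> u n \<le> real n powr \<epsilon>"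
    using assms by (auto simp: le_power_o1_def eventually_sequentially)
  define C where "C = (\<Sum>n<n0. \<bar>u n\<bar>)"
  have "filterlim (\<lambda>N. real N powr \<epsilon>) at_top sequentially"
    using \<open>\<epsilon> > 0\<close> by real_asymp
  then have "\<forall>\<^sub>F N in sequentially. C \<le> real N powr \<epsilon>"
    by (simp add: filterlim_at_top)
  then show "\<forall>\<^sub>F N in sequentially. (MAX n\<in>{1..N}. u n) \<le> real N powr (0 + \<epsilon>)"
    using eventually_ge_at_top[of 1]
  proof eventually_elim
    case (elim N)
    have "u n \<le> real N powr \<epsilon>" if "n \<in> {1..N}" for n
    proof (cases "n < n0")
      case True
      then have "\<bar>u n\<bar> \<le> C" unfolding C_def by (intro member_le_sum) auto
      then show ?thesis using elim by linarith
    next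
      case False
      then have "u n \<le> real n powr \<epsilon>" using n0 by simp
      also have "\<dots> \<le> real N powr \<epsilon>" using that \<open>\<epsilon> > 0\<close> by (intro powr_mono2) auto
      finally show ?thesis .
    qed
    then show ?case using elim by (subst Max_le_iff) auto
  qed
qed

text \<open>Each N lies below a power of two of size at most 2N. The logarithmic factor and the
  constant from doubling are absorbed in the exponent. Asking only for some \<delta> below each
  \<epsilon> lets a countable family of exponents suffice.\<close>

lemma le_power_o1_if_dyadic:
  fixes u :: "nat \<Rightarrow> real"
  assumes "c > 0"
    and *: "\<And>\<epsilon>. \<epsilon> > 0 \<Longrightarrow> \<exists>\<delta>. 0 < \<delta> \<and> \<delta> \<le> \<epsilon> \<and>
      (\<forall>\<^sub>F k in sequentially. \<forall>m\<le>2 ^ k. u m \<le> (real k + 1) * (2 ^ k) powr (c + \<delta>))"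
  shows "le_power_o1 u c"
  unfolding le_power_o1_def
proof safe
  fix \<epsilon> :: real assume "\<epsilon> > 0"
  then obtain \<delta> where \<delta>: "\<delta> > 0" "\<delta> \<le> \<epsilon> / 2"
    and ev: "\<forall>\<^sub>F k in sequentially. \<forall>m\<le>2 ^ k. u m \<le> (real k + 1) * (2 ^ k) powr (c + \<delta>)"
    using *[of "\<epsilon> / 2"] by auto
  define r where "r N = nat \<lceil>log 2 (real N)\<rceil>" for N
  have "filterlim r sequentially sequentially"
    unfolding r_def by real_asymp
  with ev have ev': "\<forall>\<^sub>F N in sequentially. \<forall>m\<le>2 ^ r N. u m \<le> (real (r N) + 1) * (2 ^ r N) powr (c + \<delta>)"
    by (auto simp: filterlim_iff)
  have lim: "((\<lambda>x::real. (log 2 x + 2) * x powr - (\<epsilon> / 2)) \<longlongrightarrow> 0) at_top"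
    using \<open>\<epsilon> > 0\<close> by real_asymp
  \<comment> \<open>The right-hand side is chosen to cancel the constant 2^(c + \<delta>) that comes
    from (2N)^(c + \<delta>). The second half of \<epsilon> pays for the logarithm.\<close>
  have "\<forall>\<^sub>F N in sequentially. (log 2 (real N) + 2) * real N powr - (\<epsilon> / 2) < 1 / 2 powr (c + \<delta>)"
    using order_tendstoD(2)[OF filterlim_compose[OF lim filterlim_real_sequentially]] by simp
  with ev' show "\<forall>\<^sub>F N in sequentially. u N \<le> real N powr (c + \<epsilon>)"
    using eventually_ge_at_top[of 1]
  proof eventually_elim
    case (elim N)
    have N: "real N \<ge> 1" using elim by simp
    have L: "log 2 (real N) \<ge> 0" using N by simp
    have r: "log 2 (real N) \<le> real (r N)" "real (r N) \<le> log 2 (real N) + 1"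
      using L unfolding r_def by linarith+
    have pow: "(2::real) ^ r N = 2 powr real (r N)" by (simp add: powr_realpow)
    have "real N = 2 powr log 2 (real N)" using N by simp
    also have "\<dots> \<le> 2 powr real (r N)" using r by (intro powr_mono) auto
    finally have "real N \<le> real (2 ^ r N)" by (simp add: powr_realpow)
    then have le: "N \<le> 2 ^ r N" by (simp only: of_nat_le_iff)
    have "(2::real) ^ r N \<le> 2 powr (log 2 (real N) + 1)"
      unfolding pow using r by (intro powr_mono) auto
    also have "\<dots> = 2 * real N" using N by (simp add: powr_add)
    finally have up: "(2::real) ^ r N \<le> 2 * real N" .
    have "u N \<le> (real (r N) + 1) * (2 ^ r N) powr (c + \<delta>)"
      using elim(1) le by blast
    also have "\<dots> \<le> (log 2 (real N) + 2) * (2 * real N) powr (c + \<delta>)"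
      using r up \<delta> \<open>c > 0\<close> L by (intro mult_mono powr_mono2) auto
    also have "\<dots> = (log 2 (real N) + 2) * (2 powr (c + \<delta>) * real N powr (c + \<delta>))"
      using N by (simp add: powr_mult)
    also have "\<dots> \<le> (log 2 (real N) + 2) * (2 powr (c + \<delta>) * real N powr (c + \<epsilon> / 2))"
      using N L \<delta> by (intro mult_left_mono powr_mono) auto
    also have "real N powr (c + \<epsilon> / 2) = real N powr (- (\<epsilon> / 2)) * real N powr (c + \<epsilon>)"
      by (simp flip: powr_add add: algebra_simps)
    also have "(log 2 (real N) + 2) * (2 powr (c + \<delta>) * (real N powr (- (\<epsilon> / 2)) * real N powr (c + \<epsilon>)))
      = ((log 2 (real N) + 2) * real N powr (- (\<epsilon> / 2))) * 2 powr (c + \<delta>) * real N powr (c + \<epsilon>)"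
      by simp
    also have "\<dots> \<le> (1 / 2 powr (c + \<delta>)) * 2 powr (c + \<delta>) * real N powr (c + \<epsilon>)"
      using elim(2) by (intro mult_right_mono) auto
    finally show ?case by simp
  qed
qed

text \<open>The \<open>N\<^sup>o\<^sup>(\<^sup>1\<^sup>)\<close> in the hypothesis depends on the double sequence; applying it to the worst signs for
  each \<open>N\<close> makes it uniform over all sign changes.\<close>

lemma uniform_sign_bound:
  fixes d :: nat and \<mu> :: "(nat \<Rightarrow> real) measure" and \<rho> \<theta> :: real and a :: "nat \<Rightarrow> complex"
  assumes hyp: "\<And>a :: nat \<Rightarrow> nat \<Rightarrow> complex.
           le_power_o1 (\<lambda>N. MAX n\<in>{1..N}. cmod (a N n)) 0 \<Longrightarrow>
           le_power_o1 (\<lambda>N. \<integral>x. cmod (weyl_sum (a N) d x N) powr \<rho> \<partial>\<mu>) (\<theta> * \<rho>)"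
    and a: "le_power_o1 (\<lambda>n. cmod (a n)) 0" and "\<epsilon> > 0"
  shows "\<forall>\<^sub>F N in sequentially. \<forall>A.
    (\<integral>x. cmod (weyl_sum (\<lambda>n. (if n \<in> A then 1 else -1) * a n) d x N) powr \<rho> \<partial>\<mu>) \<le>
      real N powr (\<theta> * \<rho> + \<epsilon>)"
proof -
  define I where "I N A =
    (\<integral>x. cmod (weyl_sum (\<lambda>n. (if n \<in> A then 1 else -1) * a n) d x N) powr \<rho> \<partial>\<mu>)" for N A
  have "\<exists>A. \<forall>A'. I N A' \<le> I N A" for N
  proof -
    \<comment> \<open>Only signs at indices up to \<open>N\<close> matter, so finitely many patterns
      compete and a worst one exists.\<close>
    have I_Int: "I N A = I N (A \<inter> {1..N})" for A
      unfolding I_def weyl_sum_def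
      by (intro arg_cong[where f = "integral\<^sup>L \<mu>"] ext arg_cong2[where f = "(powr)"]
          arg_cong[where f = cmod] sum.cong) auto
    have "finite (I N ` Pow {1..N})" by simp
    then have "\<exists>A\<in>Pow {1..N}. I N A = Max (I N ` Pow {1..N})"
      using Max_in by (metis (mono_tags, lifting) Pow_not_empty image_iff image_is_empty)
    then obtain A where A: "I N A = Max (I N ` Pow {1..N})" by blast
    have "I N A' \<le> I N A" for A'
      unfolding A I_Int[of A'] by (intro Max_ge) auto
    then show ?thesis by blast
  qed
  then obtain W where W: "\<And>N A. I N A \<le> I N (W N)" by metis
  have "le_power_o1 (\<lambda>N. MAX n\<in>{1..N}. cmod ((if n \<in> W N then 1 else -1) * a n)) 0"
  proof -
    have "cmod ((if n \<in> W N then 1 else -1) * a n) = cmod (a n)" for n N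
      by (simp add: norm_mult)
    then show ?thesis using le_power_o1_Max[OF a] by (simp only:)
  qed
  then have "le_power_o1 (\<lambda>N. I N (W N)) (\<theta> * \<rho>)"
    unfolding I_def by (rule hyp)
  with \<open>\<epsilon> > 0\<close> have "\<forall>\<^sub>F N in sequentially. I N (W N) \<le> real N powr (\<theta> * \<rho> + \<epsilon>)"
    by (simp add: le_power_o1_def)
  then show ?thesis
    unfolding I_def[symmetric] by (rule eventually_mono) (use W order_trans in blast)
qed

section \<open>Borel-Cantelli along powers of two\<close>

lemma AE_dyadic_maximal_bound:
  fixes d :: nat and \<mu> :: "(nat \<Rightarrow> real) measure" and \<rho> \<theta> :: real and a :: "nat \<Rightarrow> complex"
  assumes \<mu>: "radon_measure_on_torus d \<mu>" and "\<rho> > 0" and "\<epsilon> > 0"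
    and hyp: "\<And>a :: nat \<Rightarrow> nat \<Rightarrow> complex.
           le_power_o1 (\<lambda>N. MAX n\<in>{1..N}. cmod (a N n)) 0 \<Longrightarrow>
           le_power_o1 (\<lambda>N. \<integral>x. cmod (weyl_sum (a N) d x N) powr \<rho> \<partial>\<mu>) (\<theta> * \<rho>)"
    and a: "le_power_o1 (\<lambda>n. cmod (a n)) 0"
  shows "AE x in \<mu>. \<forall>\<^sub>F k in sequentially. \<forall>m\<le>2 ^ k.
    cmod (weyl_sum a d x m) \<le> (real k + 1) * (2 ^ k) powr (\<theta> + \<epsilon>)"
proof -
  interpret finite_measure \<mu>
    using \<mu> by (intro finite_measureI) (auto simp: radon_measure_on_torus_def)
  note [measurable] = borel_measurable_weyl_sum[OF \<mu>]
  define h where "h n x = a n * e (\<Sum>j=1..d. x j * real n ^ j)" for n x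
  have weyl: "weyl_sum a d x m = (\<Sum>n=1..m. h n x)" for x m
    by (simp add: weyl_sum_def h_def)
  have h: "h n \<in> borel_measurable \<mu>" for n
  proof -
    have "h n = (\<lambda>x. weyl_sum a d x n - weyl_sum a d x (n - 1))" if "n > 0"
      using that by (cases n) (auto simp: weyl)
    \<comment> \<open>Index 0 needs its own argument: with truncated subtraction the difference
      above would vanish, while \<open>h 0\<close> is the constant a_0.\<close>
    moreover have "h 0 = (\<lambda>x. a 0 * e 0)"
      unfolding h_def by (intro ext arg_cong[where f = "\<lambda>t. a 0 * e t"] sum.neutral) auto
    ultimately show ?thesis by (cases "n = 0") auto
  qed
  define A where "A k = {x\<in>space \<mu>. \<exists>m\<le>2 ^ k.
    cmod (\<Sum>n=1..m. h n x) > (real k + 1) * (2 ^ k) powr (\<theta> + \<epsilon>)}" for k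
  have A_sets: "A k \<in> sets \<mu>" for k
    unfolding A_def weyl[symmetric] by measurable
  \<comment> \<open>The threshold contributes \<epsilon> * \<rho> to the exponent and the mean value
    bound is used with slack \<epsilon> * \<rho> / 2. The ratio therefore still decays like q^k,
    which beats the factor k + 1 from the scales.\<close>
  define q where "q = 2 powr (- (\<epsilon> * \<rho> / 2))"
  have q: "0 < q" "q < 1"
    using \<open>\<epsilon> > 0\<close> \<open>\<rho> > 0\<close> by (auto simp: q_def powr_less_one)
  have pow2: "filterlim (\<lambda>k. 2 ^ k :: nat) sequentially sequentially"
    by (rule filterlim_subseq) (simp add: strict_mono_def)
  have sign_bound: "\<forall>\<^sub>F N in sequentially. \<forall>A.
    (\<integral>x. cmod (weyl_sum (\<lambda>n. (if n \<in> A then 1 else -1) * a n) d x N) powr \<rho> \<partial>\<mu>) \<le>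
      real N powr (\<theta> * \<rho> + \<epsilon> * \<rho> / 2)"
    by (rule uniform_sign_bound[OF _ a]) (use hyp \<open>\<epsilon> > 0\<close> \<open>\<rho> > 0\<close> in auto)
  have "\<forall>\<^sub>F k in sequentially. norm (measure \<mu> (A k)) \<le> 2 * (real (Suc k) * q ^ k)"
    using eventually_compose_filterlim[OF sign_bound pow2]
  proof eventually_elim
    case (elim k)
    define K where "K = (2 ^ k) powr (\<theta> * \<rho> + \<epsilon> * \<rho> / 2)"
    define t where "t = (2 ^ k) powr (\<theta> + \<epsilon>)"
    have "measure \<mu> (A k) \<le> (real k + 1) * (2 * K / t powr \<rho>)"
      unfolding A_def t_def[symmetric]
    proof (rule measure_maximal_partial_sum_le)
      fix n x assume "n \<in> {1..2 ^ k :: nat}"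
      then have "cmod (a n) \<le> (\<Sum>n=1..2 ^ k. cmod (a n))"
        by (intro member_le_sum) auto
      then show "cmod (h n x) \<le> (\<Sum>n=1..2 ^ k. cmod (a n))"
        by (simp add: h_def norm_mult)
    next
      fix A :: "nat set"
      show "(\<integral>x. cmod (\<Sum>n=1..2 ^ k. (if n \<in> A then 1 else -1) * h n x) powr \<rho> \<partial>\<mu>) \<le> K"
        using elim by (simp add: weyl_sum_def h_def K_def mult.assoc)
    qed (use h \<open>\<rho> > 0\<close> in \<open>auto simp: t_def\<close>)
    also have "2 * K / t powr \<rho> = 2 * (2 ^ k) powr (- (\<epsilon> * \<rho> / 2))"
      unfolding K_def t_def powr_powr times_divide_eq_right[symmetric] powr_diff[symmetric]
      by (simp add: algebra_simps)
    also have "(2 ^ k) powr (- (\<epsilon> * \<rho> / 2)) = q ^ k"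
      by (simp add: q_def powr_powr mult.commute flip: powr_realpow)
    finally show ?case
      by (simp add: algebra_simps)
  qed
  moreover have "summable (\<lambda>k. 2 * (real (Suc k) * q ^ k))"
    using geometric_deriv_sums[of q] q by (intro summable_mult) (auto simp: sums_iff)
  ultimately have "summable (\<lambda>k. measure \<mu> (A k))"
    by (rule summable_comparison_test_ev)
  then have "AE x in \<mu>. \<forall>\<^sub>F k in sequentially. x \<in> space \<mu> - A k"
    using A_sets by (intro borel_cantelli_AE1) (auto simp: less_top[symmetric])
  then show ?thesis
    by eventually_elim (auto elim!: eventually_mono simp: A_def weyl not_less)
qed

theorem theorem2p5:
  fixes d :: nat and \<mu> :: "(nat \<Rightarrow> real) measure" and \<rho> \<theta> :: real
  assumes "d \<ge> 2"
    and "radon_measure_on_torus d \<mu>"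
    and "\<rho> > 0" and "0 < \<theta>" and "\<theta> < 1"
    and "\<And>a :: nat \<Rightarrow> nat \<Rightarrow> complex.
           le_power_o1 (\<lambda>N. MAX n\<in>{1..N}. cmod (a N n)) 0 \<Longrightarrow>
           le_power_o1 (\<lambda>N. \<integral>x. cmod (weyl_sum (a N) d x N) powr \<rho> \<partial>\<mu>) (\<theta> * \<rho>)"
  shows "\<forall>a :: nat \<Rightarrow> complex. le_power_o1 (\<lambda>n. cmod (a n)) 0 \<longrightarrow>
           (AE x in \<mu>. x \<in> spt d \<mu> \<longrightarrow>
              le_power_o1 (\<lambda>N. cmod (weyl_sum a d x N)) \<theta>)"
proof safe
  fix a :: "nat \<Rightarrow> complex" assume a: "le_power_o1 (\<lambda>n. cmod (a n)) 0"
  \<comment> \<open>The exceptional null set depends on \<epsilon>, so only the countably many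
    values 1 / (i + 1) are used.\<close>
  have "AE x in \<mu>. \<forall>i. \<forall>\<^sub>F k in sequentially. \<forall>m\<le>2 ^ k.
      cmod (weyl_sum a d x m) \<le> (real k + 1) * (2 ^ k) powr (\<theta> + 1 / real (Suc i))"
    using AE_dyadic_maximal_bound[OF assms(2,3) _ assms(6) a]
    by (simp add: AE_all_countable)
  then show "AE x in \<mu>. x \<in> spt d \<mu> \<longrightarrow> le_power_o1 (\<lambda>N. cmod (weyl_sum a d x N)) \<theta>"
  proof eventually_elim
    case (elim x)
    have "le_power_o1 (\<lambda>N. cmod (weyl_sum a d x N)) \<theta>"
    proof (rule le_power_o1_if_dyadic[OF assms(4)])
      fix \<epsilon> :: real assume "\<epsilon> > 0"
      then obtain i where "1 / real (Suc i) < \<epsilon>"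
        using nat_approx_posE by (metis)
      with elim show "\<exists>\<delta>. 0 < \<delta> \<and> \<delta> \<le> \<epsilon> \<and> (\<forall>\<^sub>F k in sequentially. \<forall>m\<le>2 ^ k.
          cmod (weyl_sum a d x m) \<le> (real k + 1) * (2 ^ k) powr (\<theta> + \<delta>))"
        by (intro exI[of _ "1 / real (Suc i)"]) auto
    qed
    then show ?case by simp
  qed
qed

end
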